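(* For any natural numbers $m$ and $j$, and for $x_0$ chosen sufficiently close to $x^*$, the set $FIX=hyp_j\cup Log_m$ is accelerable by the sequence to sequence transformation $W$. That is, for every sequence $(x_n)\in FIX$, generated by an iteration function $u$ with fixed point $x^*$ via $x_{n+1}=u(x_n)$ with $x_0$ sufficiently close to $x^*$, the transformed sequence $(w_n)=W((x_n))$, $w_n=w(x_{n-1})$ for $n=1,2,\dots$, satisfies $$\lim_{n\to\infty}w_n=x^*\qquad\text{and}\qquad \lim_{n\to\infty}\frac{w_n-x^*}{x_n-x^*}=0 .$$
   Context: All functions are real, defined in a neighbourhood $D\subset\mathbb{R}$ of an isolated fixed point $x^*$. $hyp_j$ is the set of sequences $x_{n+1}=u(x_n)$ generated by iteration functions $u$ which are $j$ times continuously differentiable on $D$, with $u(x^* )=x^*$ and $|u'(x^* )|\neq 1$. $Log_m$ is the set of sequences $(x_n)$ with $x_{n+1}=u(x_n)$, $x_0\in D$, where $u$ is $m$ times continuously differentiable on $D$ and satisfies $u(x^* )=x^*$, $u'(x^* )=1$, $u^{(i)}(x^* )=0$ for $2\le i\le m-1$, and $u^{(m)}(x^* )\neq 0$. For a sequence generated by $u$, the functions $v$ and $w$ are defined near $x^*$ by $$v(x)=\frac{u(x)-x\,u'(x)}{1-u'(x)}\ \ (x\neq x^* ),\qquad v(x^* )=x^*,\qquad w(x)=\frac{v(x)-x\,v'(x)}{1-v'(x)},$$ and $W$ is the transformation $(x_n)\mapsto(w_n)$ with $w_n=w(x_{n-1})$, $n=1,2,\dots$. A sequence to sequence transformation $(x_n)\mapsto(w_n)$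 accelerates the convergence of $(x_n)$ if $w_n\to x^*$ and $\lim_{n\to\infty}(w_n-x^* )/(x_n-x^* )=0$; a set of sequences is accelerable by the transformation if the transformation accelerates every sequence in the set.
   Formalization: Formal version takes m, j ≥ 2 (w needs u''), considers only sequences that converge to x* or start on an attracting side, and for u'(x* ) = 0 claims only w_n → x*, since the ratio limit 0 fails there (u = x² gives 1). *)

theory Defs
  imports "HOL-Analysis.Analysis"
begin

definition continuously_differentiable_on :: "nat \<Rightarrow> (real \<Rightarrow> real) \<Rightarrow> real set \<Rightarrow> bool" where
  "continuously_differentiable_on k u D \<longleftrightarrow>
     (\<forall>i<k. \<forall>x\<in>D. (deriv ^^ i) u field_differentiable at x) \<and> continuous_on D ((deriv ^^ k) u)"

definition isolated_fixed_point :: "(real \<Rightarrow> real) \<Rightarrow> real \<Rightarrow> bool" where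
  "isolated_fixed_point u xstar \<longleftrightarrow> u xstar = xstar \<and> (\<forall>\<^sub>F x in at xstar. u x \<noteq> x)"

(* A fixed-point sequence is recorded together with the iteration function generating it,
   because v, w and hence W depend on u and not only on the values x n. *)
type_synonym fp_sequence = "(real \<Rightarrow> real) \<times> (nat \<Rightarrow> real)"

(* Functions are total here; nothing is assumed about u outside D, and only the starting
   point is required to lie in D. *)
definition generated_by :: "real set \<Rightarrow> (real \<Rightarrow> real) \<Rightarrow> (nat \<Rightarrow> real) \<Rightarrow> bool" where
  "generated_by D u x \<longleftrightarrow> x 0 \<in> D \<and> (\<forall>n. x (Suc n) = u (x n))"

definition hyp :: "nat \<Rightarrow> real set \<Rightarrow> real \<Rightarrow> fp_sequence set" where
  "hyp j D xstar = {(u, x). generated_by D u x \<and> isolated_fixed_point u xstar \<and>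
     continuously_differentiable_on j u D \<and> \<bar>deriv u xstar\<bar> \<noteq> 1}"

definition Log :: "nat \<Rightarrow> real set \<Rightarrow> real \<Rightarrow> fp_sequence set" where
  "Log m D xstar = {(u, x). generated_by D u x \<and> isolated_fixed_point u xstar \<and>
     continuously_differentiable_on m u D \<and> deriv u xstar = 1 \<and>
     (\<forall>i. 2 \<le> i \<and> i \<le> m - 1 \<longrightarrow> (deriv ^^ i) u xstar = 0) \<and> (deriv ^^ m) u xstar \<noteq> 0}"

definition FIX :: "nat \<Rightarrow> nat \<Rightarrow> real set \<Rightarrow> real \<Rightarrow> fp_sequence set" where
  "FIX m j D xstar = hyp j D xstar \<union> Log m D xstar"

definition v :: "(real \<Rightarrow> real) \<Rightarrow> real \<Rightarrow> real \<Rightarrow> real" where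
  "v u xstar x = (if x = xstar then xstar else (u x - x * deriv u x) / (1 - deriv u x))"

definition w :: "(real \<Rightarrow> real) \<Rightarrow> real \<Rightarrow> real \<Rightarrow> real" where
  "w u xstar x =
     (v u xstar x - x * deriv (v u xstar) x) / (1 - deriv (v u xstar) x)"

(* The transformed sequence starts at n = 1; its value at n = 0 is a dummy. *)
definition W :: "real \<Rightarrow> fp_sequence \<Rightarrow> nat \<Rightarrow> real" where
  "W xstar = (\<lambda>(u, x) n. w u xstar (x (n - 1)))"

(* If x n = xstar, the quotient at index n is 0 by the convention a / 0 = 0. *)
definition accelerates :: "(fp_sequence \<Rightarrow> nat \<Rightarrow> real) \<Rightarrow> real \<Rightarrow> fp_sequence \<Rightarrow> bool" where
  "accelerates T xstar s \<longleftrightarrow> T s \<longlonglongrightarrow> xstar \<and>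
     (\<lambda>n. (T s n - xstar) / (snd s n - xstar)) \<longlonglongrightarrow> 0"

definition accelerable :: "(fp_sequence \<Rightarrow> nat \<Rightarrow> real) \<Rightarrow> real \<Rightarrow> fp_sequence set \<Rightarrow> bool" where
  "accelerable T xstar S \<longleftrightarrow> (\<forall>s\<in>S. accelerates T xstar s)"

(* Starting points that, if close enough to xstar, are attracted by xstar: every such point
   when |u'(xstar)| < 1; when u is of logarithmic type, where
   u x - x is asymptotic to (deriv ^^ m) u xstar / fact m * (x - xstar) ^ m,
   exactly those on a side of xstar on which u moves points towards xstar. *)
definition attracting_start :: "nat \<Rightarrow> (real \<Rightarrow> real) \<Rightarrow> real \<Rightarrow> real \<Rightarrow> bool" where
  "attracting_start m u xstar x0 \<longleftrightarrow> \<bar>deriv u xstar\<bar> < 1 \<or>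
     deriv u xstar = 1 \<and> (deriv ^^ m) u xstar * (x0 - xstar) ^ (m - 1) < 0"

(* The sequences of S generated by u, started within d of xstar, for which acceleration of
   convergence is meaningful: sequences converging to xstar, where convergence need not be
   presupposed for attracting starting points. *)
definition local_sequences ::
  "nat \<Rightarrow> (real \<Rightarrow> real) \<Rightarrow> real \<Rightarrow> real \<Rightarrow> fp_sequence set \<Rightarrow> fp_sequence set" where
  "local_sequences m u xstar d S = {(u', x) \<in> S. u' = u \<and> \<bar>x 0 - xstar\<bar> < d \<and>
     (x \<longlonglongrightarrow> xstar \<or> attracting_start m u xstar (x 0))}"

end

theory Submission
  imports Defs
begin

text \<open>Put \<open>e = x - x\<^sup>*\<close>. Near the fixed point \<open>v' = u'' (u - x) / (1 - u')\<^sup>2\<close>, and both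
  \<open>(v - x\<^sup>*) / e\<close> and \<open>v'\<close> tend to the same number \<open>b \<noteq> 1\<close>: to \<open>b = 0\<close> in the hyperbolic case, and,
  by the leading Taylor terms of \<open>u - x\<close>, \<open>u' - 1\<close> and \<open>u''\<close>, to \<open>b = 1 - 1 / m\<close> in the logarithmic
  case. Hence \<open>(w - x\<^sup>*) / e = ((v - x\<^sup>*) / e - v') / (1 - v')\<close> tends to \<open>0\<close>, while
  \<open>(u - x\<^sup>*) / e\<close> tends to \<open>u'(x\<^sup>*)\<close>.\<close>

section \<open>General tools: iteration towards a fixed point and leading Taylor terms\<close>

text \<open>The distances to \<open>p\<close> decrease to some \<open>l\<close>. A cluster point
  \<open>L\<close> of the iterates has distance \<open>l\<close> from \<open>p\<close>, and by
  continuity so has \<open>u L\<close>; strict decrease then forces \<open>L = p\<close>. No uniform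
  contraction factor is assumed, which matters in the logarithmic case, where the factor tends to 1
  at the fixed point.\<close>

lemma iterates_tendsto_fixed_point:
  fixes u :: "'a::metric_space \<Rightarrow> 'a"
  assumes "compact A" and cont: "continuous_on A u" and maps: "u ` A \<subseteq> A" and fp: "u p = p"
    and closer: "\<And>y. y \<in> A \<Longrightarrow> y \<noteq> p \<Longrightarrow> dist (u y) p < dist y p"
    and x0: "x 0 \<in> A" and step: "\<And>n. x (Suc n) = u (x n)"
  shows "x \<longlonglongrightarrow> p"
proof -
  have xA: "x n \<in> A" for n
    by (induction n) (use x0 step maps in auto)
  have "dist (x (Suc n)) p \<le> dist (x n) p" for n
    using closer[OF xA[of n]] step[of n] fp by (cases "x n = p") auto
  then have "decseq (\<lambda>n. dist (x n) p)"
    by (intro decseq_SucI)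
  then obtain l where l: "(\<lambda>n. dist (x n) p) \<longlonglongrightarrow> l"
    using decseq_convergent[of "\<lambda>n. dist (x n) p" 0] by auto
  obtain L r where L: "L \<in> A" and r: "strict_mono r" and xr: "(x \<circ> r) \<longlonglongrightarrow> L"
    using \<open>compact A\<close> xA unfolding compact_def by blast
  have "(\<lambda>k. dist ((x \<circ> r) k) p) \<longlonglongrightarrow> dist L p"
    by (intro tendsto_dist xr tendsto_const)
  moreover have "(\<lambda>k. dist ((x \<circ> r) k) p) \<longlonglongrightarrow> l"
    using LIMSEQ_subseq_LIMSEQ[OF l r] by (simp add: o_def)
  ultimately have lL: "l = dist L p"
    using LIMSEQ_unique by blast
  have "(\<lambda>k. u ((x \<circ> r) k)) \<longlonglongrightarrow> u L"
    by (rule continuous_on_tendsto_compose[OF cont xr L]) (use xA in auto)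
  then have "(\<lambda>k. dist (x (Suc (r k))) p) \<longlonglongrightarrow> dist (u L) p"
    by (intro tendsto_dist tendsto_const) (simp add: step)
  moreover have "(\<lambda>k. dist (x (Suc (r k))) p) \<longlonglongrightarrow> l"
    using LIMSEQ_subseq_LIMSEQ[OF LIMSEQ_Suc[OF l] r] by (simp add: o_def)
  ultimately have "l = dist (u L) p"
    using LIMSEQ_unique by blast
  with lL closer[OF L] have "l = 0"
    by (cases "L = p") auto
  with l show ?thesis
    using tendsto_dist_iff by blast
qed

text \<open>Induction on \<open>k\<close> by l'Hopital's rule: differentiating once replaces
  \<open>diff 0\<close> by \<open>diff 1\<close> and \<open>(x - p) ^ Suc k\<close> by
  \<open>Suc k\<close> times \<open>(x - p) ^ k\<close>. The family \<open>diff\<close> is arbitrary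
  so that the induction hypothesis applies to the shifted family.\<close>

lemma taylor_leading_term:
  fixes diff :: "nat \<Rightarrow> real \<Rightarrow> real"
  assumes "\<And>i. i < k \<Longrightarrow> \<forall>\<^sub>F x in nhds p. (diff i has_real_derivative diff (Suc i) x) (at x)"
    and "\<And>i. i < k \<Longrightarrow> diff i p = 0"
    and "(diff k \<longlongrightarrow> c) (at p)"
  shows "((\<lambda>x. diff 0 x / (x - p) ^ k) \<longlongrightarrow> c / fact k) (at p)"
  using assms
proof (induction k arbitrary: diff)
  case 0
  then show ?case by simp
next
  case (Suc k)
  have IH: "((\<lambda>x. diff 1 x / (x - p) ^ k) \<longlongrightarrow> c / fact k) (at p)"
    using Suc.IH[of "\<lambda>i. diff (Suc i)"] Suc.prems by simp
  have ev: "\<forall>\<^sub>F x in nhds p. (diff 0 has_real_derivative diff 1 x) (at x)"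
    using Suc.prems(1)[of 0] by simp
  have ne: "\<forall>\<^sub>F x in at p. x \<noteq> p"
    by (simp add: eventually_at_filter)
  show ?case
  proof (rule lhopital[where f' = "diff 1" and g' = "\<lambda>x. real (Suc k) * (x - p) ^ k"])
    show "(diff 0 \<longlongrightarrow> 0) (at p)"
      using DERIV_isCont[OF eventually_nhds_x_imp_x[OF ev]] Suc.prems(2)[of 0]
      by (simp add: isCont_def)
    show "((\<lambda>x. (x - p) ^ Suc k) \<longlongrightarrow> 0) (at p)"
      by (rule tendsto_eq_intros refl | simp)+
    show "\<forall>\<^sub>F x in at p. (x - p) ^ Suc k \<noteq> 0"
      using ne by eventually_elim simp
    show "\<forall>\<^sub>F x in at p. real (Suc k) * (x - p) ^ k \<noteq> 0"
      using ne by eventually_elim simp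
    show "\<forall>\<^sub>F x in at p. (diff 0 has_real_derivative diff 1 x) (at x)"
      using ev by (auto simp: eventually_at_filter elim: eventually_mono)
    show "\<forall>\<^sub>F x in at p. ((\<lambda>x. (x - p) ^ Suc k) has_real_derivative real (Suc k) * (x - p) ^ k) (at x)"
      by (intro always_eventually allI) (rule derivative_eq_intros refl | simp)+
    have "((\<lambda>x. (diff 1 x / (x - p) ^ k) / real (Suc k)) \<longlongrightarrow> c / fact k / real (Suc k)) (at p)"
      by (intro tendsto_divide IH tendsto_const) simp
    then show "((\<lambda>x. diff 1 x / (real (Suc k) * (x - p) ^ k)) \<longlongrightarrow> c / fact (Suc k)) (at p)"
      by (simp add: mult.commute)
  qed
qed

section \<open>Derivatives of smooth iteration functions and of \<open>v\<close>\<close>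

lemma continuously_differentiable_on_has_derivative:
  assumes "continuously_differentiable_on k u D" and "i < k" and "x \<in> D"
  shows "((deriv ^^ i) u has_real_derivative (deriv ^^ Suc i) u x) (at x)"
  using assms by (simp add: continuously_differentiable_on_def DERIV_deriv_iff_field_differentiable)

lemma continuously_differentiable_on_isCont:
  assumes "continuously_differentiable_on k u D" and "i \<le> k" and "open D" and "x \<in> D"
  shows "isCont ((deriv ^^ i) u) x"
proof (cases "i = k")
  case True
  then show ?thesis
    using assms by (simp add: continuously_differentiable_on_def continuous_on_eq_continuous_at)
next
  case False
  then show ?thesis
    using assms continuously_differentiable_on_has_derivative DERIV_isCont le_neq_implies_less
    by metis
qed

text \<open>On the open set \<open>D - {p}\<close> the case distinction in \<open>v\<close>
  disappears. In the quotient rule all terms of the numerator cancel except the second derivative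
  times \<open>u x - x\<close>.\<close>

lemma v_has_derivative:
  assumes D: "open D" and cd: "continuously_differentiable_on k u D" and "2 \<le> k"
    and x: "x \<in> D" "x \<noteq> p" "deriv u x \<noteq> 1"
  shows "(v u p has_real_derivative (deriv ^^ 2) u x * (u x - x) / (1 - deriv u x)\<^sup>2) (at x)"
proof (rule has_field_derivative_transform_within_open)
  have 1: "(u has_real_derivative deriv u x) (at x)"
    using continuously_differentiable_on_has_derivative[OF cd, of 0 x] assms by simp
  have 2: "(deriv u has_real_derivative (deriv ^^ 2) u x) (at x)"
    using continuously_differentiable_on_has_derivative[OF cd, of 1 x] assms
    by (simp add: numeral_2_eq_2)
  have "((\<lambda>x. (u x - x * deriv u x) / (1 - deriv u x)) has_real_derivative
      ((deriv u x - (1 * deriv u x + (deriv ^^ 2) u x * x)) * (1 - deriv u x) -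
        (u x - x * deriv u x) * (0 - (deriv ^^ 2) u x)) / ((1 - deriv u x) * (1 - deriv u x))) (at x)"
    using x(3) by (intro DERIV_divide DERIV_diff DERIV_mult DERIV_ident DERIV_const 1 2) simp
  moreover have "(deriv u x - (1 * deriv u x + (deriv ^^ 2) u x * x)) * (1 - deriv u x) -
      (u x - x * deriv u x) * (0 - (deriv ^^ 2) u x) = (deriv ^^ 2) u x * (u x - x)"
    by (simp add: algebra_simps)
  ultimately show "((\<lambda>x. (u x - x * deriv u x) / (1 - deriv u x)) has_real_derivative
      (deriv ^^ 2) u x * (u x - x) / (1 - deriv u x)\<^sup>2) (at x)"
    by (simp only: power2_eq_square)
  show "open (D - {p})" "x \<in> D - {p}"
    using D x by auto
qed (simp add: v_def)

section \<open>Behaviour of \<open>w\<close> at the fixed point\<close>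

text \<open>Unlike \<open>v\<close>, \<open>w\<close> has no separate value at \<open>p\<close>. Its
  quotient there is \<open>p * (1 - b) / (1 - b)\<close>, so \<open>b \<noteq> 1\<close> keeps the
  denominator from vanishing.\<close>

lemma w_fixed_point:
  assumes "(v u p has_real_derivative b) (at p)" and "b \<noteq> 1"
  shows "w u p p = p"
proof -
  have "w u p p = p * (1 - b) / (1 - b)"
    by (simp add: w_def v_def DERIV_imp_deriv[OF assms(1)] right_diff_distrib)
  with \<open>b \<noteq> 1\<close> show ?thesis by simp
qed

text \<open>Since \<open>w\<close> equals x - (x - v) / (1 - v'), it is the Newton step for the
  equation x - v(x) = 0. The zero at \<open>p\<close> is simple because \<open>b \<noteq> 1\<close>,
  hence the superlinear rate.\<close>

lemma w_superlinear:
  assumes dv: "(v u p has_real_derivative b) (at p)" and lim: "(deriv (v u p) \<longlongrightarrow> b) (at p)"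
    and "b \<noteq> 1"
  shows "((\<lambda>x. (w u p x - p) / (x - p)) \<longlongrightarrow> 0) (at p)"
proof -
  let ?v' = "deriv (v u p)"
  have "((\<lambda>x. (v u p x - p) / (x - p)) \<longlongrightarrow> b) (at p)"
    using dv by (simp add: has_field_derivative_iff v_def)
  then have "((\<lambda>x. ((v u p x - p) / (x - p) - ?v' x) / (1 - ?v' x)) \<longlongrightarrow> (b - b) / (1 - b)) (at p)"
    by (intro tendsto_intros lim) (use \<open>b \<noteq> 1\<close> in auto)
  moreover have "\<forall>\<^sub>F x in at p. ((v u p x - p) / (x - p) - ?v' x) / (1 - ?v' x) = (w u p x - p) / (x - p)"
  proof -
    have "\<forall>\<^sub>F x in at p. ?v' x \<noteq> 1"
      using tendsto_imp_eventually_ne[OF lim \<open>b \<noteq> 1\<close>] .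
    moreover have "\<forall>\<^sub>F x in at p. x \<noteq> p"
      by (simp add: eventually_at_filter)
    ultimately show ?thesis
    proof eventually_elim
      case (elim x)
      then have "w u p x - p = (v u p x - p - (x - p) * ?v' x) / (1 - ?v' x)"
        by (simp add: w_def field_simps)
      with elim show ?case
        by (simp add: diff_divide_distrib mult.commute)
    qed
  qed
  ultimately show ?thesis
    by (rule tendsto_eq_rhs[OF Lim_transform_eventually]) simp
qed

section \<open>Limits of \<open>v\<close> and its derivative in the hyperbolic and logarithmic
  cases\<close>

text \<open>\<open>v\<close> is the Newton step x - (x - u) / (1 - u') for x - u(x) = 0, and
  \<open>p\<close> is a simple zero since u'(p) differs from 1. The difference quotients of
  \<open>u\<close> and the values of \<open>deriv u\<close> have the same limit, so they cancel in
  the difference quotient of \<open>v\<close>.\<close>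

lemma v_limits_hyp:
  assumes D: "open D" "p \<in> D" and cd: "continuously_differentiable_on k u D" and k: "2 \<le> k"
    and fp: "u p = p" and ne: "deriv u p \<noteq> 1"
  shows "(v u p has_real_derivative 0) (at p)" and "(deriv (v u p) \<longlongrightarrow> 0) (at p)"
proof -
  let ?a = "deriv u p"
  have du: "(u has_real_derivative ?a) (at p)"
    using continuously_differentiable_on_has_derivative[OF cd, of 0 p] D k by simp
  have u0: "(u \<longlongrightarrow> p) (at p)"
    using DERIV_isCont[OF du] fp by (simp add: isCont_def)
  have u1: "(deriv u \<longlongrightarrow> ?a) (at p)"
    using continuously_differentiable_on_isCont[OF cd, of 1 p] D k by (simp add: isCont_def)
  have u2: "((deriv ^^ 2) u \<longlongrightarrow> (deriv ^^ 2) u p) (at p)"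
    using continuously_differentiable_on_isCont[OF cd k D] by (simp add: isCont_def)
  have "\<forall>\<^sub>F x in at p. deriv u x \<noteq> 1"
    by (rule tendsto_imp_eventually_ne[OF u1 ne])
  moreover have "\<forall>\<^sub>F x in at p. x \<in> D \<and> x \<noteq> p"
    using eventually_at_in_open[OF D] by simp
  ultimately have ev: "\<forall>\<^sub>F x in at p. x \<in> D \<and> x \<noteq> p \<and> deriv u x \<noteq> 1"
    by eventually_elim simp
  have "((\<lambda>x. (u x - p) / (x - p)) \<longlongrightarrow> ?a) (at p)"
    using du fp by (simp add: has_field_derivative_iff)
  then have "((\<lambda>x. ((u x - p) / (x - p) - deriv u x) / (1 - deriv u x)) \<longlongrightarrow> (?a - ?a) / (1 - ?a)) (at p)"
    by (intro tendsto_intros u1) (use ne in auto)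
  moreover have "\<forall>\<^sub>F x in at p.
      ((u x - p) / (x - p) - deriv u x) / (1 - deriv u x) = (v u p x - v u p p) / (x - p)"
    using ev
  proof eventually_elim
    case (elim x)
    then have "v u p x - v u p p = (u x - p - (x - p) * deriv u x) / (1 - deriv u x)"
      by (simp add: v_def field_simps)
    with elim show ?case
      by (simp add: diff_divide_distrib mult.commute)
  qed
  ultimately show "(v u p has_real_derivative 0) (at p)"
    unfolding has_field_derivative_iff by (rule tendsto_eq_rhs[OF Lim_transform_eventually]) simp
  \<comment> \<open>The second derivative converges and the denominator stays away from 0, while the
    factor \<open>u x - x\<close> tends to 0.\<close>
  have "((\<lambda>x. (deriv ^^ 2) u x * (u x - x) / (1 - deriv u x)\<^sup>2) \<longlongrightarrow>
      (deriv ^^ 2) u p * (p - p) / (1 - ?a)\<^sup>2) (at p)"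
    by (intro tendsto_intros u0 u1 u2) (use ne in auto)
  moreover have "\<forall>\<^sub>F x in at p. (deriv ^^ 2) u x * (u x - x) / (1 - deriv u x)\<^sup>2 = deriv (v u p) x"
    using ev by eventually_elim (simp add: DERIV_imp_deriv[OF v_has_derivative[OF D(1) cd k]])
  ultimately show "(deriv (v u p) \<longlongrightarrow> 0) (at p)"
    by (rule tendsto_eq_rhs[OF Lim_transform_eventually]) simp
qed

text \<open>The function u(x) - x vanishes at \<open>p\<close> to order exactly \<open>m\<close>
  when \<open>c\<close> is nonzero. The three limits are its leading Taylor term and those of its
  first two derivatives.\<close>

lemma log_asymptotics:
  assumes D: "open D" "p \<in> D" and cd: "continuously_differentiable_on m u D" and m: "2 \<le> m"
    and fp: "u p = p" and d1: "deriv u p = 1"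
    and zero: "\<And>i. 2 \<le> i \<Longrightarrow> i \<le> m - 1 \<Longrightarrow> (deriv ^^ i) u p = 0"
  defines "c \<equiv> (deriv ^^ m) u p"
  shows "((\<lambda>x. (u x - x) / (x - p) ^ m) \<longlongrightarrow> c / fact m) (at p)"
    and "((\<lambda>x. (deriv u x - 1) / (x - p) ^ (m - 1)) \<longlongrightarrow> c / fact (m - 1)) (at p)"
    and "((\<lambda>x. (deriv ^^ 2) u x / (x - p) ^ (m - 2)) \<longlongrightarrow> c / fact (m - 2)) (at p)"
proof -
  \<comment> \<open>These are the iterated derivatives of u(x) - x. Subtracting the identity affects
    only orders 0 and 1, exactly where \<open>u\<close> itself does not have vanishing data at
    \<open>p\<close>.\<close>
  define diff where "diff i x = (deriv ^^ i) u x - (deriv ^^ i) (\<lambda>x. x) x" for i x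
  have id2: "(deriv ^^ Suc (Suc i)) (\<lambda>x. x) = (\<lambda>x. 0::real)" for i
    by (induction i) simp_all
  have id_deriv: "((deriv ^^ i) (\<lambda>x. x) has_real_derivative (deriv ^^ Suc i) (\<lambda>x. x) x) (at x)"
    for i and x :: real
  proof (cases i rule: nat.exhaust)
    case (Suc i')
    then show ?thesis
      by (cases i') (simp_all only: id2, simp_all)
  qed simp
  have diff0: "diff 0 = (\<lambda>x. u x - x)" and diff1: "diff (Suc 0) = (\<lambda>x. deriv u x - 1)"
    and diff2: "diff (Suc (Suc i)) = (deriv ^^ Suc (Suc i)) u" for i
    by (simp_all add: diff_def fun_eq_iff id2 del: funpow.simps) simp_all
  have diff_zero: "diff i p = 0" if "i < m" for i
  proof -
    consider "i = 0" | "i = Suc 0" | j where "i = Suc (Suc j)"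
      by (metis nat.exhaust)
    then show ?thesis
    proof cases
      case 3
      then show ?thesis
        using zero[of i] that by (simp add: diff2 del: funpow.simps)
    qed (simp_all add: diff0 diff1 fp d1)
  qed
  have diff_deriv: "\<forall>\<^sub>F x in nhds p. (diff i has_real_derivative diff (Suc i) x) (at x)" if "i < m" for i
    using eventually_nhds_in_open[OF D]
  proof eventually_elim
    case (elim x)
    show ?case
      unfolding diff_def
      by (intro DERIV_diff continuously_differentiable_on_has_derivative[OF cd that elim] id_deriv)
  qed
  obtain k where k: "m = Suc (Suc k)"
    using m by (metis Suc_le_D numeral_2_eq_2 Suc_le_mono)
  have diff_lim: "(diff m \<longlongrightarrow> c) (at p)"
    using continuously_differentiable_on_isCont[OF cd, of m p] D
    by (simp add: c_def isCont_def diff2 k del: funpow.simps)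
  show "((\<lambda>x. (u x - x) / (x - p) ^ m) \<longlongrightarrow> c / fact m) (at p)"
    using taylor_leading_term[where k = m and p = p and diff = diff and c = c] diff_deriv diff_zero diff_lim by (simp add: diff0)
  show "((\<lambda>x. (deriv u x - 1) / (x - p) ^ (m - 1)) \<longlongrightarrow> c / fact (m - 1)) (at p)"
    using taylor_leading_term[where k = "m - 1" and p = p and diff = "\<lambda>i. diff (Suc i)" and c = c] diff_deriv diff_zero diff_lim k
    by (simp add: diff1)
  have "((\<lambda>x. diff (Suc (Suc 0)) x / (x - p) ^ (m - 2)) \<longlongrightarrow> c / fact (m - 2)) (at p)"
    using taylor_leading_term[where k = "m - 2" and p = p and diff = "\<lambda>i. diff (Suc (Suc i))" and c = c]
      diff_deriv diff_zero diff_lim k by simp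
  then show "((\<lambda>x. (deriv ^^ 2) u x / (x - p) ^ (m - 2)) \<longlongrightarrow> c / fact (m - 2)) (at p)"
    by (simp add: diff2 numeral_2_eq_2 del: funpow.simps)
qed

text \<open>Newton's step for x - u(x) = 0 at a zero of multiplicity \<open>m\<close> contracts only
  linearly, with factor \<open>1 - 1 / m\<close>; this is the common limit.\<close>

lemma v_limits_log:
  assumes D: "open D" "p \<in> D" and cd: "continuously_differentiable_on m u D" and m: "2 \<le> m"
    and fp: "u p = p" and d1: "deriv u p = 1"
    and zero: "\<And>i. 2 \<le> i \<Longrightarrow> i \<le> m - 1 \<Longrightarrow> (deriv ^^ i) u p = 0"
    and nz: "(deriv ^^ m) u p \<noteq> 0"
  shows "(v u p has_real_derivative 1 - 1 / real m) (at p)"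
    and "(deriv (v u p) \<longlongrightarrow> 1 - 1 / real m) (at p)"
proof -
  define c where "c = (deriv ^^ m) u p"
  \<comment> \<open>Dividing out the leading powers leaves \<open>p0\<close>, \<open>p1\<close>,
    \<open>p2\<close> with nonzero limits, so every remaining limit is that of a rational expression
    in them.\<close>
  define p0 where "p0 x = (u x - x) / (x - p) ^ m" for x
  define p1 where "p1 x = (deriv u x - 1) / (x - p) ^ (m - 1)" for x
  define p2 where "p2 x = (deriv ^^ 2) u x / (x - p) ^ (m - 2)" for x
  have lim0: "(p0 \<longlongrightarrow> c / fact m) (at p)" and lim1: "(p1 \<longlongrightarrow> c / fact (m - 1)) (at p)"
    and lim2: "(p2 \<longlongrightarrow> c / fact (m - 2)) (at p)"
    unfolding p0_def p1_def p2_def c_def by (rule log_asymptotics[OF D cd m fp d1 zero]; assumption)+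
  have c: "c \<noteq> 0"
    using nz by (simp add: c_def)
  obtain k where k: "m = Suc (Suc k)"
    using m by (metis Suc_le_D numeral_2_eq_2 Suc_le_mono)
  have "\<forall>\<^sub>F x in at p. p1 x \<noteq> 0"
    by (rule tendsto_imp_eventually_ne[OF lim1]) (use c in simp)
  moreover have "\<forall>\<^sub>F x in at p. x \<in> D \<and> x \<noteq> p"
    using eventually_at_in_open[OF D] by simp
  ultimately have ev: "\<forall>\<^sub>F x in at p. x \<in> D \<and> x \<noteq> p \<and> p1 x \<noteq> 0"
    by eventually_elim simp
  have u0: "u x = x + p0 x * (x - p) ^ m" and u1: "deriv u x = 1 + p1 x * (x - p) ^ (m - 1)"
    and u2: "(deriv ^^ 2) u x = p2 x * (x - p) ^ (m - 2)" if "x \<noteq> p" for x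
    using that by (simp_all add: p0_def p1_def p2_def)
  have "((\<lambda>x. 1 - p0 x / p1 x) \<longlongrightarrow> 1 - (c / fact m) / (c / fact (m - 1))) (at p)"
    by (intro tendsto_intros lim0 lim1) (use c in simp)
  moreover have "\<forall>\<^sub>F x in at p. 1 - p0 x / p1 x = (v u p x - v u p p) / (x - p)"
    using ev
  proof eventually_elim
    case (elim x)
    then have x: "x \<noteq> p" and p1: "p1 x \<noteq> 0"
      by auto
    \<comment> \<open>With \<open>e * E\<close> in place of the \<open>m\<close>-th power, the
      identity becomes rational in \<open>e\<close> and \<open>E\<close> and no exponent arithmetic
      is left.\<close>
    define e E where "e = x - p" and "E = e ^ (m - 1)"
    have e: "e \<noteq> 0" "E \<noteq> 0" "x = p + e"
      using x by (simp_all add: e_def E_def)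
    have 0: "u x = p + e + p0 x * (e * E)" and 1: "deriv u x = 1 + p1 x * E"
      using u0[OF x] u1[OF x] by (simp_all add: E_def e_def k)
    have "v u p x - p = (p + e + p0 x * (e * E) - (p + e) * (1 + p1 x * E)) / (- (p1 x * E)) - p"
      using x by (simp add: v_def 0 1 flip: e(3))
    also have "\<dots> = e * (1 - p0 x / p1 x)"
      using e(1,2) p1 by (simp add: field_simps)
    finally show ?case
      using e(1) by (simp add: e_def v_def)
  qed
  moreover have "1 - (c / fact m) / (c / fact (m - 1)) = 1 - 1 / real m"
    using c by (simp add: k)
  ultimately show "(v u p has_real_derivative 1 - 1 / real m) (at p)"
    unfolding has_field_derivative_iff by (rule tendsto_eq_rhs[OF Lim_transform_eventually])
  have "((\<lambda>x. p2 x * p0 x / (p1 x)\<^sup>2) \<longlongrightarrow>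
      (c / fact (m - 2)) * (c / fact m) / (c / fact (m - 1))\<^sup>2) (at p)"
    by (intro tendsto_intros lim0 lim1 lim2) (use c in simp)
  moreover have "\<forall>\<^sub>F x in at p. p2 x * p0 x / (p1 x)\<^sup>2 = deriv (v u p) x"
    using ev
  proof eventually_elim
    case (elim x)
    then have x: "x \<in> D" "x \<noteq> p" and e: "x - p \<noteq> 0"
      by auto
    have "deriv u x \<noteq> 1"
      using elim by (simp add: u1)
    then have "deriv (v u p) x = (deriv ^^ 2) u x * (u x - x) / (1 - deriv u x)\<^sup>2"
      using x by (intro DERIV_imp_deriv v_has_derivative[OF D(1) cd m])
    \<comment> \<open>The powers of \<open>x - p\<close> cancel because (m - 2) + m = 2 (m -
      1).\<close>
    also have "\<dots> = p2 x * p0 x / (p1 x)\<^sup>2"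
      unfolding u0[OF x(2)] u1[OF x(2)] u2[OF x(2)] using elim e
      by (simp add: k power_mult_distrib power2_eq_square)
    finally show ?case ..
  qed
  moreover have "(c / fact (m - 2)) * (c / fact m) / (c / fact (m - 1))\<^sup>2 = 1 - 1 / real m"
  proof -
    \<comment> \<open>Here \<open>F\<close> stands for (m - 2)!, \<open>a\<close> for m - 1 and
      \<open>b\<close> for m, so the other two factorials are \<open>a * F\<close> and
      \<open>b * (a * F)\<close>.\<close>
    have "(c / F) * (c / (b * (a * F))) / (c / (a * F))\<^sup>2 = a / b"
      if "a \<noteq> 0" "b \<noteq> 0" "F \<noteq> 0" for a b F :: real
      using that c by (simp add: field_simps power2_eq_square)
    from this[of "real (Suc k)" "real (Suc (Suc k))" "fact k"] show ?thesis
      by (simp add: k field_simps del: of_nat_Suc)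
  qed
  ultimately show "(deriv (v u p) \<longlongrightarrow> 1 - 1 / real m) (at p)"
    by (rule tendsto_eq_rhs[OF Lim_transform_eventually])
qed

section \<open>From the limits of \<open>v\<close> to acceleration by \<open>W\<close>\<close>

text \<open>Because of the index shift in \<open>W\<close>, the quotient at \<open>Suc n\<close> is
  (w - p) / (u - p) evaluated at \<open>x n\<close>. Dividing both differences by
  \<open>x n - p\<close> turns it into a quotient with limit \<open>0 / a\<close>, whence the
  condition on \<open>a\<close>.\<close>

lemma W_accelerates:
  assumes dv: "(v u p has_real_derivative b) (at p)" and lim: "(deriv (v u p) \<longlongrightarrow> b) (at p)"
    and b: "b \<noteq> 1" and fp: "u p = p" and du: "(u has_real_derivative a) (at p)"
    and x: "x \<longlonglongrightarrow> p" and step: "\<And>n. x (Suc n) = u (x n)"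
  shows "W p (u, x) \<longlonglongrightarrow> p" and "a \<noteq> 0 \<Longrightarrow> accelerates (W p) p (u, x)"
proof -
  note sup = w_superlinear[OF dv lim b] and wp = w_fixed_point[OF dv b]
  \<comment> \<open>The superlinear estimate together with \<open>w u p p = p\<close> says that
    \<open>w\<close> has derivative 0 at \<open>p\<close>; continuity follows.\<close>
  have "(w u p has_real_derivative 0) (at p)"
    using sup wp by (simp add: has_field_derivative_iff)
  then have "isCont (w u p) p"
    by (rule DERIV_isCont)
  then have "(\<lambda>n. w u p (x n)) \<longlonglongrightarrow> p"
    using isCont_tendsto_compose[OF _ x] wp by fastforce
  then have "(\<lambda>n. W p (u, x) (Suc n)) \<longlonglongrightarrow> p"
    by (simp add: W_def)
  then show lim_W: "W p (u, x) \<longlonglongrightarrow> p"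
    by (rule LIMSEQ_imp_Suc)
  assume a: "a \<noteq> 0"
  have "((\<lambda>y. (u y - p) / (y - p)) \<longlongrightarrow> a) (at p)"
    using du fp by (simp add: has_field_derivative_iff)
  then have "((\<lambda>y. ((w u p y - p) / (y - p)) / ((u y - p) / (y - p))) \<longlongrightarrow> 0 / a) (at p)"
    by (intro tendsto_divide sup a)
  moreover have "\<forall>\<^sub>F y in at p.
      ((w u p y - p) / (y - p)) / ((u y - p) / (y - p)) = (w u p y - p) / (u y - p)"
    by (simp add: eventually_at_filter)
  ultimately have "((\<lambda>y. (w u p y - p) / (u y - p)) \<longlongrightarrow> 0) (at p)"
    by (rule tendsto_eq_rhs[OF Lim_transform_eventually]) simp
  \<comment> \<open>At \<open>p\<close> the quotient is 0 / 0 = 0 by convention, which is also its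
    limit. Continuity thus covers sequences that reach \<open>p\<close>.\<close>
  then have "isCont (\<lambda>y. (w u p y - p) / (u y - p)) p"
    by (simp add: isCont_def wp)
  then have "(\<lambda>n. (w u p (x n) - p) / (u (x n) - p)) \<longlonglongrightarrow> 0"
    using isCont_tendsto_compose[OF _ x] wp by fastforce
  then have "(\<lambda>n. (W p (u, x) (Suc n) - p) / (x (Suc n) - p)) \<longlonglongrightarrow> 0"
    by (simp add: W_def step)
  then have "(\<lambda>n. (W p (u, x) n - p) / (x n - p)) \<longlonglongrightarrow> 0"
    by (rule LIMSEQ_imp_Suc)
  with lim_W show "accelerates (W p) p (u, x)"
    by (simp add: accelerates_def)
qed

section \<open>Local attraction of starting points\<close>

text \<open>The difference quotient of \<open>u\<close> at \<open>p\<close> has absolute value below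
  1 nearby, so \<open>u\<close> strictly reduces the distance to \<open>p\<close>. The closed ball
  whose radius is the initial distance is then compact and invariant.\<close>

lemma hyp_attraction:
  fixes u :: "real \<Rightarrow> real"
  assumes cont: "\<forall>\<^sub>F y in nhds p. isCont u y" and fp: "u p = p"
    and du: "(u has_real_derivative a) (at p)" and a: "\<bar>a\<bar> < 1"
  shows "\<exists>d>0. \<forall>x. \<bar>x 0 - p\<bar> < d \<longrightarrow> (\<forall>n. x (Suc n) = u (x n)) \<longrightarrow> x \<longlonglongrightarrow> p"
proof -
  have "((\<lambda>y. \<bar>(u y - p) / (y - p)\<bar>) \<longlongrightarrow> \<bar>a\<bar>) (at p)"
    using du fp by (intro tendsto_rabs) (simp add: has_field_derivative_iff)
  then have "\<forall>\<^sub>F y in at p. \<bar>(u y - p) / (y - p)\<bar> < 1"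
    using a by (rule order_tendstoD)
  then have "\<forall>\<^sub>F y in nhds p. y \<noteq> p \<longrightarrow> \<bar>(u y - p) / (y - p)\<bar> < 1"
    by (simp add: eventually_at_filter)
  with cont have "\<forall>\<^sub>F y in nhds p. isCont u y \<and> (y \<noteq> p \<longrightarrow> \<bar>(u y - p) / (y - p)\<bar> < 1)"
    by (rule eventually_conj)
  then obtain d where d: "d > 0"
    and *: "\<And>y. dist y p < d \<Longrightarrow> isCont u y \<and> (y \<noteq> p \<longrightarrow> \<bar>(u y - p) / (y - p)\<bar> < 1)"
    unfolding eventually_nhds_metric by blast
  have closer: "dist (u y) p < dist y p" if "dist y p < d" "y \<noteq> p" for y
    using *[OF that(1)] that(2) by (simp add: dist_real_def field_simps)
  have "x \<longlonglongrightarrow> p" if x0: "\<bar>x 0 - p\<bar> < d" and step: "\<forall>n. x (Suc n) = u (x n)" for x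
  proof (rule iterates_tendsto_fixed_point[where A = "cball p (dist (x 0) p)" and u = u])
    have near: "dist y p < d" if "y \<in> cball p (dist (x 0) p)" for y
      using that x0 by (simp add: dist_real_def abs_minus_commute)
    show "continuous_on (cball p (dist (x 0) p)) u"
      using near * by (intro continuous_at_imp_continuous_on) blast
    show "dist (u y) p < dist y p" if "y \<in> cball p (dist (x 0) p)" "y \<noteq> p" for y
      using that closer near by blast
    show "u ` cball p (dist (x 0) p) \<subseteq> cball p (dist (x 0) p)"
    proof (intro image_subsetI)
      fix y assume "y \<in> cball p (dist (x 0) p)"
      then show "u y \<in> cball p (dist (x 0) p)"
        using closer[OF near, of y] fp by (cases "y = p") (auto simp: dist_commute)
    qed
  qed (use fp step in \<open>auto simp: dist_commute\<close>)
  with d show ?thesis by blast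
qed

text \<open>Write u(y) - p = (1 + t) (y - p) with t = q(y) (y - p)^(m - 1). Near \<open>p\<close>,
  \<open>t\<close> is small and \<open>q\<close> has the sign of \<open>c\<close>, so on the side
  selected by the sign condition -1 < t < 0. Iterates approach \<open>p\<close> monotonically
  without crossing it.\<close>

lemma log_attraction:
  fixes u :: "real \<Rightarrow> real"
  assumes cont: "\<forall>\<^sub>F y in nhds p. isCont u y" and fp: "u p = p" and m: "2 \<le> m"
    and lim: "((\<lambda>y. (u y - y) / (y - p) ^ m) \<longlongrightarrow> c / fact m) (at p)" and c: "c \<noteq> 0"
  shows "\<exists>d>0. \<forall>x. \<bar>x 0 - p\<bar> < d \<longrightarrow> c * (x 0 - p) ^ (m - 1) < 0 \<longrightarrow>
    (\<forall>n. x (Suc n) = u (x n)) \<longrightarrow> x \<longlonglongrightarrow> p"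
proof -
  define q where "q y = (u y - y) / (y - p) ^ m" for y
  have lim': "(q \<longlongrightarrow> c / fact m) (at p)"
    using lim by (simp add: q_def[abs_def])
  have "((\<lambda>y. c * q y) \<longlongrightarrow> c * (c / fact m)) (at p)"
    by (intro tendsto_intros lim')
  moreover have "0 < c * (c / fact m)"
    using c by (auto simp: zero_less_mult_iff zero_less_divide_iff)
  ultimately have "\<forall>\<^sub>F y in at p. 0 < c * q y"
    by (rule order_tendstoD)
  \<comment> \<open>As \<open>m\<close> is at least 2, this limit is 0. The bound -1 drawn from it
    keeps the factor \<open>1 + t\<close> positive.\<close>
  moreover have "((\<lambda>y. q y * (y - p) ^ (m - 1)) \<longlongrightarrow> c / fact m * (p - p) ^ (m - 1)) (at p)"
    by (intro tendsto_intros lim')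
  then have "\<forall>\<^sub>F y in at p. - 1 < q y * (y - p) ^ (m - 1)"
    by (rule order_tendstoD) (use m in \<open>simp add: power_0_left\<close>)
  ultimately have "\<forall>\<^sub>F y in at p. 0 < c * q y \<and> - 1 < q y * (y - p) ^ (m - 1)"
    by (rule eventually_conj)
  then have "\<forall>\<^sub>F y in nhds p. y \<noteq> p \<longrightarrow> 0 < c * q y \<and> - 1 < q y * (y - p) ^ (m - 1)"
    by (simp add: eventually_at_filter)
  with cont have "\<forall>\<^sub>F y in nhds p. isCont u y \<and>
      (y \<noteq> p \<longrightarrow> 0 < c * q y \<and> - 1 < q y * (y - p) ^ (m - 1))"
    by (rule eventually_conj)
  then obtain d where d: "d > 0" and *: "\<And>y. dist y p < d \<Longrightarrow> isCont u y \<and>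
      (y \<noteq> p \<longrightarrow> 0 < c * q y \<and> - 1 < q y * (y - p) ^ (m - 1))"
    unfolding eventually_nhds_metric by blast
  have contract: "\<exists>r. 0 < r \<and> r < 1 \<and> u y - p = r * (y - p)"
    if y: "dist y p < d" "y \<noteq> p" and neg: "c * (y - p) ^ (m - 1) < 0" for y
  proof -
    define t where "t = q y * (y - p) ^ (m - 1)"
    have pos: "0 < c * q y" and t: "- 1 < t"
      using * y by (auto simp: t_def)
    have "(c * q y) * (c * (y - p) ^ (m - 1)) < 0"
      using pos neg by (rule mult_pos_neg)
    then have "c\<^sup>2 * t < 0"
      by (simp add: t_def power2_eq_square mult_ac)
    then have "t < 0"
      by (simp add: mult_less_0_iff)
    moreover have "u y - y = q y * (y - p) ^ m"
      using y by (simp add: q_def)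
    then have "u y - y = t * (y - p)"
      using m by (simp add: t_def power_eq_if)
    ultimately show ?thesis
      using t by (intro exI[of _ "1 + t"]) (simp add: algebra_simps)
  qed
  have "x \<longlonglongrightarrow> p" if x0: "\<bar>x 0 - p\<bar> < d" and neg: "c * (x 0 - p) ^ (m - 1) < 0"
    and step: "\<forall>n. x (Suc n) = u (x n)" for x
  proof -
    \<comment> \<open>The segment from \<open>p\<close> to \<open>x 0\<close>, parametrised so that
      starts on the left and on the right of \<open>p\<close> are treated alike.\<close>
    define A where "A = (\<lambda>s. p + s * (x 0 - p)) ` {0..1}"
    have A_cases: "\<exists>s. 0 \<le> s \<and> s \<le> 1 \<and> y = p + s * (x 0 - p)" if "y \<in> A" for y
      using that unfolding A_def by (elim imageE) auto
    have near: "dist y p < d" if y: "y \<in> A" for y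
    proof -
      obtain s where "0 \<le> s" "s \<le> 1" "y = p + s * (x 0 - p)"
        using A_cases[OF y] by blast
      then have "dist y p \<le> \<bar>x 0 - p\<bar>"
        by (simp add: dist_real_def abs_mult mult_left_le_one_le)
      with x0 show ?thesis by simp
    qed
    have negA: "c * (y - p) ^ (m - 1) < 0" if y: "y \<in> A" "y \<noteq> p" for y
    proof -
      obtain s where s: "0 \<le> s" "y = p + s * (x 0 - p)"
        using A_cases[OF y(1)] by blast
      with y(2) have "0 < s"
        by (cases "s = 0") auto
      then have "s ^ (m - 1) * (c * (x 0 - p) ^ (m - 1)) < 0"
        by (rule mult_pos_neg[OF zero_less_power neg])
      then show ?thesis
        by (simp add: s power_mult_distrib mult_ac)
    qed
    show ?thesis
    proof (rule iterates_tendsto_fixed_point[where A = A and u = u])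
      show "compact A"
        unfolding A_def by (intro compact_continuous_image continuous_intros) simp
      show "continuous_on A u"
        using near * by (intro continuous_at_imp_continuous_on) blast
      show "u ` A \<subseteq> A"
      proof (intro image_subsetI)
        fix y assume y: "y \<in> A"
        show "u y \<in> A"
        proof (cases "y = p")
          case True
          with y fp show ?thesis by simp
        next
          case False
          then obtain r where r: "0 < r" "r < 1" "u y - p = r * (y - p)"
            using contract[OF near[OF y] False negA[OF y False]] by blast
          obtain s where s: "0 \<le> s" "s \<le> 1" "y = p + s * (x 0 - p)"
            using A_cases[OF y] by blast
          \<comment> \<open>Applying \<open>u\<close> multiplies the parameter \<open>s\<close> by
            \<open>r\<close>, so the image stays on the segment.\<close>
          then have "y - p = s * (x 0 - p)"
            by linarith
          then have "u y = p + (r * s) * (x 0 - p)"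
            using r(3) by (simp add: mult.assoc diff_eq_eq add.commute)
          moreover have "r * s \<in> {0..1}"
            using r s by (simp add: mult_le_one)
          ultimately show ?thesis
            unfolding A_def by blast
        qed
      qed
      show "dist (u y) p < dist y p" if y: "y \<in> A" "y \<noteq> p" for y
      proof -
        obtain r where "0 < r" "r < 1" "u y - p = r * (y - p)"
          using contract[OF near[OF y(1)] y(2) negA[OF y]] by blast
        then show ?thesis
          using y by (simp add: dist_real_def abs_mult)
      qed
      show "x 0 \<in> A"
        unfolding A_def by (rule image_eqI[of _ _ 1]) auto
    qed (use fp step in auto)
  qed
  with d show ?thesis by blast
qed

section \<open>Accelerability of \<open>FIX\<close>\<close>

text \<open>The radius \<open>d\<close> depends on \<open>u\<close> alone and serves all its
  sequences. Orders at least 2 provide the continuous second derivative that governs v'.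
  Acceleration is restricted to nonzero u' at the fixed point: for \<open>u x = x ^ 2\<close> at 0,
  w(x) / u(x) tends to 1, so \<open>W\<close> converges without accelerating.\<close>

theorem proposition7:
  fixes D :: "real set" and xstar :: real and m j :: nat
  assumes "open D" and "xstar \<in> D" and "2 \<le> m" and "2 \<le> j"
  shows "\<forall>u. \<exists>d>0.
    (\<forall>s \<in> local_sequences m u xstar d (FIX m j D xstar). W xstar s \<longlonglongrightarrow> xstar) \<and>
    (deriv u xstar \<noteq> 0 \<longrightarrow>
      accelerable (W xstar) xstar (local_sequences m u xstar d (FIX m j D xstar)))"
proof
  fix u
  let ?FIX = "FIX m j D xstar"
  let ?goal = "\<exists>d>0. (\<forall>s \<in> local_sequences m u xstar d ?FIX. W xstar s \<longlonglongrightarrow> xstar) \<and>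
    (deriv u xstar \<noteq> 0 \<longrightarrow> accelerable (W xstar) xstar (local_sequences m u xstar d ?FIX))"
  have step: "x (Suc n) = u (x n)" if "(u, x) \<in> ?FIX" for x n
    using that by (auto simp: FIX_def hyp_def Log_def generated_by_def)
  \<comment> \<open>Both classes of \<open>u\<close> need only two things: a common limit
    \<open>b\<close> other than 1 for \<open>v\<close>, and a radius within which attracting starts
    converge.\<close>
  have reduce: ?goal
    if fp: "u xstar = xstar" and du: "(u has_real_derivative deriv u xstar) (at xstar)"
      and v: "(v u xstar has_real_derivative b) (at xstar)"
        "(deriv (v u xstar) \<longlongrightarrow> b) (at xstar)" "b \<noteq> 1"
      and attr: "\<exists>d>0. \<forall>x. \<bar>x 0 - xstar\<bar> < d \<longrightarrow> attracting_start m u xstar (x 0) \<longrightarrow>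
        (\<forall>n. x (Suc n) = u (x n)) \<longrightarrow> x \<longlonglongrightarrow> xstar" for b
  proof -
    obtain d where d: "d > 0" and
      *: "\<And>x. \<bar>x 0 - xstar\<bar> < d \<Longrightarrow> attracting_start m u xstar (x 0) \<Longrightarrow>
        (\<forall>n. x (Suc n) = u (x n)) \<Longrightarrow> x \<longlonglongrightarrow> xstar"
      using attr by blast
    have conv: "x \<longlonglongrightarrow> xstar \<and> (\<forall>n. x (Suc n) = u (x n))" and eq: "u' = u"
      if "(u', x) \<in> local_sequences m u xstar d ?FIX" for u' x
      using that * step by (auto simp: local_sequences_def)
    note acc = W_accelerates[OF v fp du]
    show ?thesis
    proof (intro exI[of _ d] conjI ballI impI d)
      fix s assume s: "s \<in> local_sequences m u xstar d ?FIX"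
      show "W xstar s \<longlonglongrightarrow> xstar"
        using s acc(1) conv eq by (cases s) blast
    next
      assume "deriv u xstar \<noteq> 0"
      then show "accelerable (W xstar) xstar (local_sequences m u xstar d ?FIX)"
        unfolding accelerable_def using acc(2) conv eq by (metis prod.exhaust)
    qed
  qed
  have smooth: "(u has_real_derivative deriv u xstar) (at xstar)"
      "\<forall>\<^sub>F y in nhds xstar. isCont u y"
    if cd: "continuously_differentiable_on k u D" and k: "2 \<le> k" for k
  proof -
    show "(u has_real_derivative deriv u xstar) (at xstar)"
      using continuously_differentiable_on_has_derivative[OF cd, of 0 xstar] assms k by simp
    show "\<forall>\<^sub>F y in nhds xstar. isCont u y"
      using eventually_nhds_in_open[OF assms(1,2)]
      by eventually_elim (use continuously_differentiable_on_isCont[OF cd, of 0] assms in simp)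
  qed
  \<comment> \<open>The witness \<open>x\<close> is used only to read off the properties of
    \<open>u\<close>. If there is none, the set of local sequences is empty and any radius
    works.\<close>
  consider (none) "\<nexists>x. (u, x) \<in> ?FIX" | (hyp) x where "(u, x) \<in> hyp j D xstar"
    | (Log) x where "(u, x) \<in> Log m D xstar"
    by (auto simp: FIX_def)
  then show ?goal
  proof cases
    case none
    then have "local_sequences m u xstar 1 ?FIX = {}"
      by (auto simp: local_sequences_def)
    then show ?thesis
      by (intro exI[of _ 1]) (simp add: accelerable_def)
  next
    case hyp
    then have cd: "continuously_differentiable_on j u D" and ne: "\<bar>deriv u xstar\<bar> \<noteq> 1"
      and fp: "u xstar = xstar"
      by (auto simp: hyp_def isolated_fixed_point_def)
    have ne1: "deriv u xstar \<noteq> 1"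
      using ne by auto
    have "\<exists>d>0. \<forall>x. \<bar>x 0 - xstar\<bar> < d \<longrightarrow> attracting_start m u xstar (x 0) \<longrightarrow>
        (\<forall>n. x (Suc n) = u (x n)) \<longrightarrow> x \<longlonglongrightarrow> xstar"
    proof (cases "\<bar>deriv u xstar\<bar> < 1")
      case True
      then show ?thesis
        using hyp_attraction[OF smooth(2)[OF cd assms(4)] fp smooth(1)[OF cd assms(4)]] by blast
    next
      \<comment> \<open>At a repelling point no start is attracting, so only sequences already known
        to converge remain and any radius works.\<close>
      case False
      then show ?thesis
        using ne1 by (intro exI[of _ 1]) (simp add: attracting_start_def)
    qed
    then show ?thesis
      using reduce[OF fp smooth(1)[OF cd assms(4)] v_limits_hyp[OF assms(1,2) cd assms(4) fp ne1]]
      by simp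
  next
    case Log
    then have cd: "continuously_differentiable_on m u D" and d1: "deriv u xstar = 1"
      and fp: "u xstar = xstar" and nz: "(deriv ^^ m) u xstar \<noteq> 0"
      and zero: "\<And>i. 2 \<le> i \<Longrightarrow> i \<le> m - 1 \<Longrightarrow> (deriv ^^ i) u xstar = 0"
      by (auto simp: Log_def isolated_fixed_point_def)
    have "\<exists>d>0. \<forall>x. \<bar>x 0 - xstar\<bar> < d \<longrightarrow> attracting_start m u xstar (x 0) \<longrightarrow>
        (\<forall>n. x (Suc n) = u (x n)) \<longrightarrow> x \<longlonglongrightarrow> xstar"
      using log_attraction[OF smooth(2)[OF cd assms(3)] fp assms(3)
          log_asymptotics(1)[OF assms(1,2) cd assms(3) fp d1 zero] nz]
      by (simp add: attracting_start_def d1)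
    \<comment> \<open>Here \<open>b\<close> is \<open>1 - 1 / real m\<close>, which differs from 1
      since \<open>m\<close> is positive.\<close>
    then show ?thesis
      using reduce[OF fp smooth(1)[OF cd assms(3)]
          v_limits_log[OF assms(1,2) cd assms(3) fp d1 zero nz]] assms(3)
      by simp
  qed
qed

end
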